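(* Let $\mathcal H\subseteq 2^V$ be a hypergraph satisfying the following three properties: (A1) $\mathcal H$ is minimal transversal-free; (D1) for every pair of hyperedges $H,H'\in\mathcal H$ there is a chain $H_0,H_1,\dots,H_p$ in $\mathcal H$ with $H_0=H$, $H_p=H'$, and $H_i\subseteq H\cup H'$ for $i=1,\dots,p$; (D2) for every position $x\in\mathbb Z_{\ge0}^V$ with $m(x)>0$ there is a hyperedge $H\in\mathcal H$ such that $h_{\mathcal H}(x-\chi(H))=h_{\mathcal H}(x)-1$ and $m(x-\chi(H))=m(x)-1$. Then $\mathcal H$ is JM.
   Context: Let $V=\{1,\dots,n\}$. A hypergraph is a family $\mathcal H\subseteq 2^V$ with $\mathcal H\neq\emptyset$, $\emptyset\notin\mathcal H$, $V=\bigcup_{H\in\mathcal H}H$. The game $NIM_{\mathcal H}$ is played on positions $x\in\mathbb{Z}_{\ge 0}^V$; a move ($H$-move) $x\to x'$ chooses $H\in\mathcal H$ and goes to any $x'\in\mathbb Z_{\ge0}^V$ with $x'_i<x_i$ for $i\in H$ and $x'_i=x_i$ for $i\notin H$. Players alternate; the player who cannot move loses. The Sprague–Grundy function is $\mathcal G_{\mathcal H}(x)=\mathrm{mex}\{\mathcal G_{\mathcal H}(x') : x\to x' \text{ a move}\}$ ($\mathrm{mex}(S)$ = least nonnegative integer not in $S$). The height $h_{\mathcal H}(x)$ is the maximum number of consecutive moves possible from $x$. With $e$ the all-ones vector, $m(x)=\min_{i}x_i$, $y_{\mathcal H}(x)=h_{\mathcal H}(x-m(x)e)+1$, $v_{\mathcal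 H}(x)=\binom{y_{\mathcal H}(x)}{2}+\big((m(x)-\binom{y_{\mathcal H}(x)}{2}-1)\bmod y_{\mathcal H}(x)\big)$ (residue in $\{0,\dots,y_{\mathcal H}(x)-1\}$), and $f_{\mathcal H}(x)=h_{\mathcal H}(x)$ if $m(x)\le\binom{y_{\mathcal H}(x)}{2}$, else $f_{\mathcal H}(x)=v_{\mathcal H}(x)$. $\mathcal H$ is JM if $\mathcal G_{\mathcal H}=f_{\mathcal H}$ on $\mathbb Z_{\ge0}^V$. $\chi(H)$ is the characteristic vector of $H$. A set $T$ is a transversal of $\mathcal H$ if it meets every hyperedge; $\mathcal H$ is transversal-free if no hyperedge is a transversal of $\mathcal H$; with $\mathcal H_S=\{H\in\mathcal H:H\subseteq S\}$, $\mathcal H$ is minimal transversal-free if it is transversal-free and for every $S\subsetneq V$ with $\mathcal H_S\neq\emptyset$, $\mathcal H_S$ is not transversal-free. A sequence $H_0,\dots,H_p$ of hyperedges ($p\ge0$) is a chain if $H_{k+1}\cap H_k\neq\emptyset$ and $|H_{k+1}\setminus H_k|\le1$ for $k=0,\dots,p-1$. *)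

theory Defs
  imports Main "HOL-Library.Indicator_Function"
begin

text \<open>The vertex set is the universe of a finite type \<open>'v\<close>, so its size \<open>n\<close> is arbitrary, and
  positions are the total functions \<open>'v \<Rightarrow> nat\<close>.\<close>

definition hypergraph :: "'v set set \<Rightarrow> bool" where
  "hypergraph \<H> \<longleftrightarrow> \<H> \<noteq> {} \<and> {} \<notin> \<H> \<and> \<Union>\<H> = UNIV"

definition move :: "'v set set \<Rightarrow> ('v \<Rightarrow> nat) \<Rightarrow> ('v \<Rightarrow> nat) \<Rightarrow> bool" where
  "move \<H> x x' \<longleftrightarrow> (\<exists>H\<in>\<H>. (\<forall>i\<in>H. x' i < x i) \<and> (\<forall>i. i \<notin> H \<longrightarrow> x' i = x i))"

definition mex :: "nat set \<Rightarrow> nat" where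
  "mex S = (LEAST k. k \<notin> S)"

text \<open>The recursion is well-founded only because hyperedges are nonempty, hence \<open>wfrec\<close>; the
  recursion equation is \<open>grundy_eq\<close> below.\<close>

definition grundy :: "'v set set \<Rightarrow> ('v \<Rightarrow> nat) \<Rightarrow> nat" where
  "grundy \<H> = wfrec {(x', x). move \<H> x x'} (\<lambda>g x. mex {g x' |x'. move \<H> x x'})"

definition height :: "'v set set \<Rightarrow> ('v \<Rightarrow> nat) \<Rightarrow> nat" where
  "height \<H> x = Max {k. \<exists>x'. (move \<H> ^^ k) x x'}"

definition min_coord :: "('v::finite \<Rightarrow> nat) \<Rightarrow> nat" where
  "min_coord x = Min (range x)"

definition y_val :: "'v::finite set set \<Rightarrow> ('v \<Rightarrow> nat) \<Rightarrow> nat" where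
  "y_val \<H> x = height \<H> (\<lambda>i. x i - min_coord x) + 1"

text \<open>The residue is taken over \<open>int\<close>, since \<open>m(x) - (y choose 2) - 1\<close> may be negative.\<close>

definition v_val :: "'v::finite set set \<Rightarrow> ('v \<Rightarrow> nat) \<Rightarrow> nat" where
  "v_val \<H> x = (y_val \<H> x choose 2) +
     nat ((int (min_coord x) - int (y_val \<H> x choose 2) - 1) mod int (y_val \<H> x))"

definition f_val :: "'v::finite set set \<Rightarrow> ('v \<Rightarrow> nat) \<Rightarrow> nat" where
  "f_val \<H> x = (if min_coord x \<le> (y_val \<H> x choose 2) then height \<H> x else v_val \<H> x)"

definition JM :: "'v::finite set set \<Rightarrow> bool" where
  "JM \<H> \<longleftrightarrow> (\<forall>x. grundy \<H> x = f_val \<H> x)"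

definition transversal :: "'v set set \<Rightarrow> 'v set \<Rightarrow> bool" where
  "transversal \<H> T \<longleftrightarrow> (\<forall>H\<in>\<H>. T \<inter> H \<noteq> {})"

definition transversal_free :: "'v set set \<Rightarrow> bool" where
  "transversal_free \<H> \<longleftrightarrow> (\<forall>H\<in>\<H>. \<not> transversal \<H> H)"

definition induced :: "'v set set \<Rightarrow> 'v set \<Rightarrow> 'v set set" where
  "induced \<H> S = {H \<in> \<H>. H \<subseteq> S}"

definition minimal_transversal_free :: "'v set set \<Rightarrow> bool" where
  "minimal_transversal_free \<H> \<longleftrightarrow> transversal_free \<H> \<and>
     (\<forall>S. S \<subset> UNIV \<and> induced \<H> S \<noteq> {} \<longrightarrow> \<not> transversal_free (induced \<H> S))"

text \<open>\<open>chain \<H> p C\<close>: the sequence \<open>C 0, \<dots>, C p\<close> is a chain; values of \<open>C\<close> beyond \<open>p\<close> are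
  irrelevant.\<close>

definition chain :: "'v set set \<Rightarrow> nat \<Rightarrow> (nat \<Rightarrow> 'v set) \<Rightarrow> bool" where
  "chain \<H> p C \<longleftrightarrow> (\<forall>k\<le>p. C k \<in> \<H>) \<and>
     (\<forall>k<p. C (Suc k) \<inter> C k \<noteq> {} \<and> card (C (Suc k) - C k) \<le> 1)"

text \<open>The lemmas below show that \<open>grundy\<close>, \<open>height\<close> and \<open>min_coord\<close> are well defined, and that
  no \<open>nat\<close> subtraction truncates in the positions and heights where it is used.\<close>

lemma move_sum_less:
  fixes \<H> :: "'v::finite set set"
  assumes "hypergraph \<H>" "move \<H> x x'"
  shows "sum x' UNIV < sum x UNIV"
proof -
  from assms(2) obtain H where H: "H \<in> \<H>" "\<forall>i\<in>H. x' i < x i" "\<forall>i. i \<notin> H \<longrightarrow> x' i = x i"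
    unfolding move_def by blast
  have "H \<noteq> {}" using H(1) assms(1) unfolding hypergraph_def by auto
  then obtain j where "j \<in> H" by blast
  moreover have "\<forall>i\<in>UNIV. x' i \<le> x i" using H by (metis le_less)
  ultimately show ?thesis using H(2) by (intro sum_strict_mono_ex1) auto
qed

lemma wf_move:
  fixes \<H> :: "'v::finite set set"
  assumes "hypergraph \<H>"
  shows "wf {(x', x). move \<H> x x'}"
  by (rule wf_subset[OF wf_measure[of "\<lambda>x. sum x UNIV"]]) (auto dest: move_sum_less[OF assms])

lemma grundy_eq:
  fixes \<H> :: "'v::finite set set"
  assumes "hypergraph \<H>"
  shows "grundy \<H> x = mex {grundy \<H> x' |x'. move \<H> x x'}"
proof -
  have "{cut (grundy \<H>) {(x', x). move \<H> x x'} x x' |x'. move \<H> x x'}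
      = {grundy \<H> x' |x'. move \<H> x x'}"
    by (auto simp: cut_def)
  then show ?thesis
    using wfrec[OF wf_move[OF assms], of "\<lambda>g x. mex {g x' |x'. move \<H> x x'}" x]
    unfolding grundy_def[symmetric] by simp
qed

lemma relpowp_move_le:
  fixes \<H> :: "'v::finite set set"
  assumes "hypergraph \<H>" "(move \<H> ^^ k) x x'"
  shows "k + sum x' UNIV \<le> sum x UNIV"
  using assms(2)
proof (induction k arbitrary: x')
  case (Suc k)
  then obtain z where "(move \<H> ^^ k) x z" "move \<H> z x'" by auto
  with Suc.IH[of z] move_sum_less[OF assms(1)] show ?case by fastforce
qed simp

lemma finite_move_lengths:
  fixes \<H> :: "'v::finite set set"
  assumes "hypergraph \<H>"
  shows "finite {k. \<exists>x'. (move \<H> ^^ k) x x'}"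
  by (rule finite_subset[of _ "{..sum x UNIV}"]) (auto dest: relpowp_move_le[OF assms])

lemma min_coord_le: "min_coord x \<le> x i"
  unfolding min_coord_def by simp

lemma height_pos:
  fixes \<H> :: "'v::finite set set"
  assumes "hypergraph \<H>" "min_coord x > 0"
  shows "height \<H> x > 0"
proof -
  from assms(1) obtain H where "H \<in> \<H>" unfolding hypergraph_def by blast
  moreover have "x i > 0" for i using assms(2) min_coord_le[of x i] by simp
  ultimately have "move \<H> x (\<lambda>i. x i - indicator H i)"
    unfolding move_def by (intro bexI[of _ H]) auto
  then have "(move \<H> ^^ 1) x (\<lambda>i. x i - indicator H i)" by (simp only: relpowp_1)
  then have "1 \<in> {k. \<exists>x'. (move \<H> ^^ k) x x'}" by blast
  then have "1 \<le> height \<H> x"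
    unfolding height_def by (intro Max_ge finite_move_lengths[OF assms(1)])
  then show ?thesis by simp
qed

end

theory Submission
  imports Defs
begin

text \<open>
  Lowering one coordinate by one lowers the height by at most one, so along a coordinatewise
  descent every intermediate height occurs. Chains of hyperedges glue the descents belonging to
  different hyperedges: if zeroing \<open>H\<^sub>k\<close> leaves height \<open>> t\<close>, then zeroing \<open>H\<^sub>k \<inter> H\<^sub>k\<^sub>+\<^sub>1\<close> and
  lowering the single remaining vertex of \<open>H\<^sub>k\<^sub>+\<^sub>1\<close> by one is an \<open>H\<^sub>k\<^sub>+\<^sub>1\<close>-move to height \<open>\<ge> t\<close>.
  (D2) provides a high start of the descent, and minimality in (A1) a hyperedge that, once zeroed,
  leaves height at most \<open>m(x)\<close>. A move to a position with prescribed \<open>m\<close> and \<open>y\<close> is obtained by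
  applying this to a translate \<open>x - c e\<close>. That no move preserves \<open>f\<close> needs only a hyperedge
  disjoint from the one that is played.
\<close>

section \<open>Elementary facts on moves and the minimum coordinate\<close>

lemma moveI:
  assumes "H \<in> \<H>" "\<And>i. i \<in> H \<Longrightarrow> x' i < x i" "\<And>i. i \<notin> H \<Longrightarrow> x' i = x i"
  shows "move \<H> x x'"
  using assms unfolding move_def by blast

lemma moveE:
  assumes "move \<H> x x'"
  obtains H where "H \<in> \<H>" "\<And>i. i \<in> H \<Longrightarrow> x' i < x i" "\<And>i. i \<notin> H \<Longrightarrow> x' i = x i"
  using assms unfolding move_def by blast

lemma move_le: "move \<H> x x' \<Longrightarrow> x' i \<le> x i"
  by (erule moveE) (metis le_less)

lemma le_min_coord_iff: "k \<le> min_coord x \<longleftrightarrow> (\<forall>i. k \<le> x i)"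
  unfolding min_coord_def by (subst Min_ge_iff) auto

lemma min_coord_attained: obtains i where "x i = min_coord x"
proof -
  have "min_coord x \<in> range x" unfolding min_coord_def by (intro Min_in) auto
  then show thesis using that by force
qed

lemma min_coord_eq_0_iff: "min_coord x = 0 \<longleftrightarrow> (\<exists>i. x i = 0)"
  by (metis min_coord_attained min_coord_le le_zero_eq)

lemma min_coord_mono: "(\<And>i. x i \<le> z i) \<Longrightarrow> min_coord x \<le> min_coord z"
  unfolding le_min_coord_iff by (meson min_coord_le order_trans)

lemma min_coord_eqI: "(\<And>j. c \<le> x j) \<Longrightarrow> x i = c \<Longrightarrow> min_coord x = c"
  by (metis le_antisym le_min_coord_iff min_coord_le)

lemma min_coord_diff: "min_coord (\<lambda>i. x i - c) = min_coord x - c"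
proof -
  obtain i where "x i = min_coord x" by (rule min_coord_attained)
  then show ?thesis
    by (intro min_coord_eqI[where i = i]) (auto intro: diff_le_mono min_coord_le)
qed

lemma min_coord_add: "min_coord (\<lambda>i. x i + c) = min_coord x + c"
proof -
  obtain i where "x i = min_coord x" by (rule min_coord_attained)
  then show ?thesis
    by (intro min_coord_eqI[where i = i]) (auto intro: min_coord_le)
qed

section \<open>Blocks of integers between consecutive triangular numbers\<close>

lemma Suc_choose_two: "Suc n choose 2 = (n choose 2) + n"
  by (simp add: numeral_2_eq_2)

lemma choose_two_mono: "m \<le> n \<Longrightarrow> m choose 2 \<le> n choose 2"
  by (rule lift_Suc_mono_le[of "\<lambda>n. n choose 2"]) (simp_all add: Suc_choose_two)

lemma choose_two_add_less: "a < b \<Longrightarrow> r < a \<Longrightarrow> (a choose 2) + r < b choose 2"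
  using choose_two_mono[of "Suc a" b] by (simp add: Suc_choose_two)

text \<open>The blocks from \<open>n choose 2\<close> up to but excluding
  \<open>Suc n choose 2\<close> have length \<open>n\<close> and tile the naturals. A value of
  \<open>v_val\<close> lies in block number \<open>y_val\<close>, its offset being the
  residue.\<close>

lemma choose_two_decomp:
  fixes z :: nat
  obtains n r where "z = (n choose 2) + r" "r < n"
proof -
  have "\<exists>n r. z = (n choose 2) + r \<and> r < n"
  proof (induction z)
    case 0
    \<comment> \<open>Block 0 is empty, so 0 opens block 1.\<close>
    show ?case by (intro exI[of _ 1] exI[of _ 0]) simp
  next
    case (Suc z)
    then obtain n r where "z = (n choose 2) + r" "r < n" by blast
    then show ?case
    proof (cases "Suc r < n")
      case True
      with \<open>z = _\<close> show ?thesis by (intro exI[of _ n] exI[of _ "Suc r"]) simp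
    next
      case False
      with \<open>z = _\<close> \<open>r < n\<close> show ?thesis
        by (intro exI[of _ "Suc n"] exI[of _ 0]) (auto simp: Suc_choose_two)
    qed
  qed
  then show thesis using that by blast
qed

text \<open>Distinct blocks do not overlap; hence equal values of \<open>v_val\<close> force equal
  \<open>y_val\<close>.\<close>

lemma choose_two_decomp_unique:
  assumes "(a choose 2) + r = (b choose 2) + s" "r < a" "s < b"
  shows "a = b"
  using assms choose_two_add_less[of a b r] choose_two_add_less[of b a s]
  by (cases a b rule: linorder_cases) linarith+

section \<open>The height function\<close>

context
  fixes \<H> :: "'v::finite set set"
  assumes hyp: "hypergraph \<H>"
begin

text \<open>Initial segments of plays are plays, so the set of lengths under \<open>Max\<close> is
  downward closed.\<close>

lemma le_height_iff: "k \<le> height \<H> x \<longleftrightarrow> (\<exists>x'. (move \<H> ^^ k) x x')"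
proof
  let ?K = "{k. \<exists>x'. (move \<H> ^^ k) x x'}"
  have fin: "finite ?K" by (rule finite_move_lengths[OF hyp])
  show "k \<le> height \<H> x" if "\<exists>x'. (move \<H> ^^ k) x x'"
    using that fin unfolding height_def by (intro Max_ge) auto
  have "0 \<in> ?K" by simp
  then have "Max ?K \<in> ?K" using fin by (intro Max_in) blast+
  then obtain x' where *: "(move \<H> ^^ height \<H> x) x x'" unfolding height_def by blast
  show "\<exists>x'. (move \<H> ^^ k) x x'" if "k \<le> height \<H> x"
  proof -
    have "(move \<H> ^^ (k + (height \<H> x - k))) x x'" using * that by simp
    then show ?thesis unfolding relpowp_add by blast
  qed
qed

lemma Suc_le_height_iff: "Suc k \<le> height \<H> x \<longleftrightarrow> (\<exists>x'. move \<H> x x' \<and> k \<le> height \<H> x')"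
  unfolding le_height_iff by (metis relpowp_Suc_E2 relpowp_Suc_I2)

lemma height_move_less: "move \<H> x x' \<Longrightarrow> height \<H> x' < height \<H> x"
  using Suc_le_height_iff[of "height \<H> x'" x] by auto

text \<open>A play from \<open>x\<close> can be copied from \<open>z\<close>: each move uses the
  same hyperedge with the same new values on it, and domination persists elsewhere.\<close>

lemma height_mono:
  assumes "\<And>i. x i \<le> z i"
  shows "height \<H> x \<le> height \<H> z"
proof -
  have "k \<le> height \<H> z" if "k \<le> height \<H> x" for k
    using that assms
  proof (induction k arbitrary: x z)
    case (Suc k)
    then obtain x' where x': "move \<H> x x'" "k \<le> height \<H> x'"
      by (auto simp: Suc_le_height_iff)
    from x'(1) obtain H where H: "H \<in> \<H>" "\<And>i. i \<in> H \<Longrightarrow> x' i < x i" "\<And>i. i \<notin> H \<Longrightarrow> x' i = x i"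
      by (rule moveE) blast
    let ?z = "\<lambda>i. if i \<in> H then x' i else z i"
    have "move \<H> z ?z"
      using H Suc.prems(2) by (intro moveI[of H]) (auto intro: less_le_trans)
    moreover have "k \<le> height \<H> ?z"
      using H Suc.prems(2) by (intro Suc.IH[OF x'(2)]) auto
    ultimately show ?case unfolding Suc_le_height_iff by blast
  qed simp
  then show ?thesis by blast
qed

text \<open>A play from \<open>x\<close> is copied until its first move that uses \<open>i\<close>.
  That move is skipped: its target is dominated by the lowered position, so only one move is
  lost.\<close>

lemma height_decrement: "height \<H> x \<le> Suc (height \<H> (x(i := x i - 1)))"
proof -
  have "k \<le> height \<H> (x(i := x i - 1))" if "Suc k \<le> height \<H> x" for k
    using that
  proof (induction k arbitrary: x)
    case (Suc k)
    then obtain x' where x': "move \<H> x x'" "Suc k \<le> height \<H> x'"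
      using Suc_le_height_iff by blast
    from x'(1) obtain H where H: "H \<in> \<H>" "\<And>i. i \<in> H \<Longrightarrow> x' i < x i" "\<And>i. i \<notin> H \<Longrightarrow> x' i = x i"
      by (rule moveE) blast
    show ?case
    proof (cases "i \<in> H")
      case True
      then have "x' j \<le> (x(i := x i - 1)) j" for j
        using H(2)[of i] move_le[OF x'(1)] by auto
      then show ?thesis using x'(2) height_mono by (meson order_trans)
    next
      case False
      then have "move \<H> (x(i := x i - 1)) (x'(i := x' i - 1))"
        using H by (intro moveI[of H]) auto
      then show ?thesis using Suc.IH[OF x'(2)] Suc_le_height_iff by blast
    qed
  qed simp
  then show ?thesis by (cases "height \<H> x") auto
qed

lemma height_set_zero: "height \<H> x \<le> height \<H> (x(i := 0)) + x i"
proof (induction "x i" arbitrary: x)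
  case 0
  then show ?case by (simp add: fun_upd_idem)
next
  case (Suc n)
  have "height \<H> (x(i := x i - 1)) \<le> height \<H> (x(i := 0)) + n"
    using Suc.hyps(1)[of "x(i := x i - 1)"] Suc.hyps(2)[symmetric] by simp
  then show ?case using height_decrement[of x i] Suc.hyps(2) by simp
qed

lemma height_ge_on_edge:
  assumes "H \<in> \<H>" "\<And>i. i \<in> H \<Longrightarrow> c \<le> x i"
  shows "c \<le> height \<H> x"
  using assms(2)
proof (induction c arbitrary: x)
  case (Suc c)
  have "move \<H> x (\<lambda>i. x i - indicator H i)"
    using Suc.prems assms(1) by (intro moveI[of H]) force+
  moreover have "c \<le> height \<H> (\<lambda>i. x i - indicator H i)"
    using Suc.prems by (intro Suc.IH) force
  ultimately show ?case unfolding Suc_le_height_iff by blast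
qed simp

text \<open>Supports only shrink during play, so every move of the play uses \<open>i\<close> and
  lowers its value.\<close>

lemma height_le_coord:
  assumes "\<And>H. H \<in> \<H> \<Longrightarrow> (\<And>j. j \<in> H \<Longrightarrow> x j > 0) \<Longrightarrow> i \<in> H"
  shows "height \<H> x \<le> x i"
proof -
  have "k \<le> x i" if "k \<le> height \<H> x" for k
    using that assms
  proof (induction k arbitrary: x)
    case (Suc k)
    then obtain x' where x': "move \<H> x x'" "k \<le> height \<H> x'"
      by (auto simp: Suc_le_height_iff)
    from x'(1) obtain H where H: "H \<in> \<H>" "\<And>i. i \<in> H \<Longrightarrow> x' i < x i" "\<And>i. i \<notin> H \<Longrightarrow> x' i = x i"
      by (rule moveE) blast
    have "i \<in> H" using Suc.prems(2)[OF H(1)] H(2) by (metis gr_zeroI not_less_zero)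
    moreover have "k \<le> x' i"
      using move_le[OF x'(1)] by (intro Suc.IH[OF x'(2)] Suc.prems(2)) (auto intro: less_le_trans)
    ultimately show ?case using H(2)[of i] by simp
  qed simp
  then show ?thesis by blast
qed

lemma min_coord_le_height: "min_coord x \<le> height \<H> x"
proof -
  obtain H where "H \<in> \<H>" using hyp unfolding hypergraph_def by blast
  then show ?thesis by (rule height_ge_on_edge) (rule min_coord_le)
qed

text \<open>A discrete intermediate value argument: each unit decrement between \<open>w\<close> and
  \<open>w'\<close> costs at most one unit of height, so no height is skipped.\<close>

lemma height_descent:
  assumes "\<And>i. w' i \<le> w i" "height \<H> w' \<le> t" "t \<le> height \<H> w"
  obtains u where "\<And>i. w' i \<le> u i" "\<And>i. u i \<le> w i" "height \<H> u = t"
proof -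
  have "\<exists>u. (\<forall>i. w' i \<le> u i \<and> u i \<le> w i) \<and> height \<H> u = t"
    using assms
  proof (induction "sum w UNIV" arbitrary: w rule: less_induct)
    case less
    show ?case
    proof (cases "height \<H> w = t")
      case True
      then show ?thesis using less.prems(1) by blast
    next
      case False
      with less.prems have "w \<noteq> w'" by auto
      then obtain i where i: "w' i < w i" using less.prems(1) by (metis ext le_less)
      let ?w = "w(i := w i - 1)"
      have "sum ?w UNIV < sum w UNIV"
        using i by (intro sum_strict_mono_ex1) auto
      moreover have "\<And>j. w' j \<le> ?w j" using i less.prems(1) by auto
      moreover have "t \<le> height \<H> ?w"
        using height_decrement[of w i] False less.prems(3) by linarith
      ultimately obtain u where "\<forall>j. w' j \<le> u j \<and> u j \<le> ?w j" "height \<H> u = t"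
        using less.hyps less.prems(2) by blast
      moreover from this have "u j \<le> w j" for j
        by (metis diff_le_self fun_upd_apply order_trans)
      ultimately show ?thesis by blast
    qed
  qed
  then show thesis using that by blast
qed

text \<open>The first move of a long play is weakened to unit decrements on its hyperedge; the
  result dominates the original target.\<close>

lemma good_edge_exists:
  assumes "t < height \<H> x"
  obtains H where "H \<in> \<H>" "\<And>i. i \<in> H \<Longrightarrow> x i > 0" "t \<le> height \<H> (\<lambda>i. x i - indicator H i)"
proof -
  from assms obtain x' where x': "move \<H> x x'" "t \<le> height \<H> x'"
    using Suc_le_height_iff[of t x] by (auto simp: Suc_le_eq)
  from x'(1) obtain H where H: "H \<in> \<H>" "\<And>i. i \<in> H \<Longrightarrow> x' i < x i" "\<And>i. i \<notin> H \<Longrightarrow> x' i = x i"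
    by (rule moveE) blast
  have "x' i \<le> x i - indicator H i" for i
    using H(2)[of i] H(3)[of i] by (cases "i \<in> H") auto
  then have "t \<le> height \<H> (\<lambda>i. x i - indicator H i)"
    using x'(2) height_mono by (meson order_trans)
  then show thesis using that H by (metis gr_zeroI not_less_zero)
qed

section \<open>Values of \<open>f_val\<close> and why no move preserves them\<close>

lemma v_val_eq:
  assumes "y_val \<H> x choose 2 < min_coord x"
  shows "v_val \<H> x = (y_val \<H> x choose 2) + (min_coord x - (y_val \<H> x choose 2) - 1) mod y_val \<H> x"
proof -
  have "int (min_coord x) - int (y_val \<H> x choose 2) - 1
      = int (min_coord x - (y_val \<H> x choose 2) - 1)"
    using assms by simp
  then show ?thesis unfolding v_val_def by (metis nat_int zmod_int)
qed

lemma y_val_pos: "y_val \<H> x > 0"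
  unfolding y_val_def by simp

text \<open>A residue is at most its dividend. The bound separates the second branch of
  \<open>f_val\<close> from heights, which are never below the minimum coordinate.\<close>

lemma v_val_less_min_coord:
  assumes "y_val \<H> x choose 2 < min_coord x"
  shows "v_val \<H> x < min_coord x"
  using assms mod_less_eq_dividend[of "min_coord x - (y_val \<H> x choose 2) - 1" "y_val \<H> x"]
  unfolding v_val_eq[OF assms] by linarith

context
  assumes tf: "transversal_free \<H>"
begin

lemma disjoint_edge:
  assumes "H \<in> \<H>"
  obtains H' where "H' \<in> \<H>" "H \<inter> H' = {}"
  using tf assms unfolding transversal_free_def transversal_def by blast

lemma f_val_move_neq:
  assumes "move \<H> x x'"
  shows "f_val \<H> x' \<noteq> f_val \<H> x"
proof
  assume eq: "f_val \<H> x' = f_val \<H> x"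
  from assms obtain H where H: "H \<in> \<H>" "\<And>i. i \<in> H \<Longrightarrow> x' i < x i" "\<And>i. i \<notin> H \<Longrightarrow> x' i = x i"
    by (rule moveE) blast
  obtain H' where H': "H' \<in> \<H>" "H \<inter> H' = {}" using disjoint_edge[OF H(1)] by blast
  have untouched: "min_coord x \<le> x' i" if "i \<in> H'" for i
    using that H' H(3) min_coord_le[of x i] by (metis disjoint_iff)
  have le: "min_coord x' \<le> min_coord x"
    by (intro min_coord_mono move_le[OF assms])
  let ?y = "y_val \<H> x" and ?y' = "y_val \<H> x'"
  consider "min_coord x \<le> ?y choose 2" "min_coord x' \<le> ?y' choose 2"
    | "min_coord x \<le> ?y choose 2" "?y' choose 2 < min_coord x'"
    | "?y choose 2 < min_coord x" "min_coord x' \<le> ?y' choose 2"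
    | "?y choose 2 < min_coord x" "?y' choose 2 < min_coord x'"
    by linarith
  then show False
  proof cases
    case 1
    then show False using eq height_move_less[OF assms] by (simp add: f_val_def)
  next
    case 2
    then show False
      using eq v_val_less_min_coord[of x'] le min_coord_le_height[of x] by (simp add: f_val_def)
  next
    case 3
    \<comment> \<open>Playing \<open>H'\<close> alone still lasts \<open>min_coord x\<close> moves
      after the move, whereas \<open>f_val\<close> at \<open>x\<close> is below
      \<open>min_coord x\<close>.\<close>
    have "min_coord x \<le> height \<H> x'"
      using height_ge_on_edge[OF H'(1) untouched] .
    then show False using 3 eq v_val_less_min_coord[of x] by (simp add: f_val_def)
  next
    case 4
    let ?C = "?y choose 2"
    have v: "(?y' choose 2) + (min_coord x' - (?y' choose 2) - 1) mod ?y'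
        = ?C + (min_coord x - ?C - 1) mod ?y"
      using eq 4 by (simp add: f_val_def v_val_eq)
    then have y: "?y' = ?y"
      by (rule choose_two_decomp_unique) (simp_all add: y_val_pos)
    with v have "(min_coord x' - ?C - 1) mod ?y = (min_coord x - ?C - 1) mod ?y" by simp
    then have dvd: "?y dvd min_coord x - min_coord x'"
      using le 4 y mod_eq_dvd_iff_nat[of "min_coord x' - ?C - 1" "min_coord x - ?C - 1" ?y] by simp
    show False
    proof (cases "min_coord x' = min_coord x")
      case True
      \<comment> \<open>With equal minima the shifted positions are again joined by an
        \<open>H\<close>-move, so their heights differ, against the equality of the two
        \<open>y_val\<close>.\<close>
      have "move \<H> (\<lambda>i. x i - min_coord x) (\<lambda>i. x' i - min_coord x')"
        using H True min_coord_le[of x'] by (intro moveI[of H]) (auto intro: diff_less_mono)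
      then show False using height_move_less y unfolding y_val_def by fastforce
    next
      case False
      \<comment> \<open>The minimum falls by at least \<open>?y\<close>, so the shifted values on
        \<open>H'\<close> are at least \<open>?y\<close>; but the shifted height is
        \<open>?y - 1\<close>.\<close>
      then have "?y \<le> min_coord x - min_coord x'" using dvd le by (intro dvd_imp_le) auto
      also have "\<dots> \<le> height \<H> (\<lambda>i. x' i - min_coord x')"
        using untouched by (intro height_ge_on_edge[OF H'(1)] diff_le_mono)
      finally show False using y unfolding y_val_def by simp
    qed
  qed
qed

end

section \<open>Reaching a prescribed height with minimum zero\<close>

context
  assumes A1: "minimal_transversal_free \<H>"
    and D1: "\<forall>H\<in>\<H>. \<forall>H'\<in>\<H>. \<exists>p C. chain \<H> p C \<and> C 0 = H \<and> C p = H' \<and>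
               (\<forall>i\<in>{1..p}. C i \<subseteq> H \<union> H')"
begin

lemma tf: "transversal_free \<H>"
  using A1 unfolding minimal_transversal_free_def by blast

text \<open>Delete from the support of \<open>u\<close> a vertex \<open>i\<close> attaining the
  minimum. By minimality some hyperedge \<open>H\<close> in the remaining set \<open>S\<close> meets
  all hyperedges in \<open>S\<close>. Once \<open>H\<close> is zeroed, every playable hyperedge must
  contain \<open>i\<close>, so at most \<open>u i\<close> moves remain.\<close>

lemma low_edge_exists:
  assumes "H\<^sub>0 \<in> \<H>" "\<And>i. i \<in> H\<^sub>0 \<Longrightarrow> u i > 0"
  obtains H where "H \<in> \<H>" "\<And>i. i \<in> H \<Longrightarrow> u i > 0"
    "height \<H> (\<lambda>i. if i \<in> H then 0 else u i) \<le> min_coord u"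
proof -
  obtain i where i: "u i = min_coord u" by (rule min_coord_attained)
  define S where "S = {j. j \<noteq> i \<and> u j > 0}"
  \<comment> \<open>If the minimum is zero, \<open>H\<^sub>0\<close> already avoids
    \<open>i\<close>. Otherwise \<open>S\<close> omits only \<open>i\<close>, and a hyperedge
    disjoint from one through \<open>i\<close> lies in \<open>S\<close>.\<close>
  have "induced \<H> S \<noteq> {}"
  proof (cases "u i = 0")
    case True
    then have "H\<^sub>0 \<subseteq> S" using assms(2) unfolding S_def by force
    then show ?thesis using assms(1) unfolding induced_def by blast
  next
    case False
    obtain K where K: "K \<in> \<H>" "i \<in> K" using hyp unfolding hypergraph_def by blast
    obtain H where H: "H \<in> \<H>" "K \<inter> H = {}" using disjoint_edge[OF tf K(1)] by blast
    have "u j > 0" for j using False i min_coord_le[of u j] by linarith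
    then have "H \<subseteq> S" using H K unfolding S_def by auto
    then show ?thesis using H(1) unfolding induced_def by blast
  qed
  moreover have "S \<subset> UNIV" unfolding S_def by auto
  ultimately have "\<not> transversal_free (induced \<H> S)"
    using A1 unfolding minimal_transversal_free_def by blast
  then obtain H where H: "H \<in> \<H>" "H \<subseteq> S" "\<And>K. K \<in> \<H> \<Longrightarrow> K \<subseteq> S \<Longrightarrow> H \<inter> K \<noteq> {}"
    unfolding transversal_free_def transversal_def induced_def by blast
  let ?u = "\<lambda>i. if i \<in> H then 0 else u i"
  have "height \<H> ?u \<le> ?u i"
  proof (rule height_le_coord)
    fix K assume K: "K \<in> \<H>" "\<And>j. j \<in> K \<Longrightarrow> ?u j > 0"
    then have "H \<inter> K = {}" by fastforce
    then have "\<not> K \<subseteq> S" using H(3) K(1) by blast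
    moreover have "\<And>j. j \<in> K \<Longrightarrow> u j > 0" using K(2) by (metis less_irrefl)
    ultimately show "i \<in> K" unfolding S_def by blast
  qed
  then have "height \<H> ?u \<le> min_coord u" using i by (cases "i \<in> H") auto
  then show thesis using that H(1,2) unfolding S_def by blast
qed

text \<open>The chain leads from the hyperedge of the given move to one whose zeroing is low. At the
  first low hyperedge on it, a high target of a move is also available, and a descent between the
  two hits \<open>t\<close>.\<close>

lemma reach_height_zero_min:
  assumes start: "move \<H> u w" "min_coord w = 0" "t \<le> height \<H> w"
    and t: "min_coord u \<le> t"
  obtains u' where "move \<H> u u'" "min_coord u' = 0" "height \<H> u' = t"
proof -
  define zeroed where "zeroed H = (\<lambda>i. if i \<in> H then 0 else u i)" for H
  \<comment> \<open>The upper end of a descent inside \<open>H\<close>, whose lower end is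
    \<open>zeroed H\<close>. Its zero coordinate survives the descent and gives the new position
    minimum zero.\<close>
  define high where "high H \<longleftrightarrow> (\<exists>w. (\<forall>i\<in>H. w i < u i) \<and> (\<forall>i. i \<notin> H \<longrightarrow> w i = u i) \<and>
      (\<exists>i. w i = 0) \<and> t \<le> height \<H> w)" for H
  from start(1) obtain H\<^sub>0
    where H\<^sub>0: "H\<^sub>0 \<in> \<H>" "\<And>i. i \<in> H\<^sub>0 \<Longrightarrow> w i < u i" "\<And>i. i \<notin> H\<^sub>0 \<Longrightarrow> w i = u i"
    by (rule moveE) blast
  then have pos0: "\<And>i. i \<in> H\<^sub>0 \<Longrightarrow> u i > 0" by (metis gr_zeroI not_less_zero)
  have high0: "high H\<^sub>0" unfolding high_def using H\<^sub>0(2,3) start(2,3) min_coord_eq_0_iff by blast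
  obtain H where H: "H \<in> \<H>" "\<And>i. i \<in> H \<Longrightarrow> u i > 0" "height \<H> (zeroed H) \<le> min_coord u"
    unfolding zeroed_def by (rule low_edge_exists[OF H\<^sub>0(1) pos0]) blast+
  obtain p C where C: "chain \<H> p C" "C 0 = H\<^sub>0" "C p = H" "\<forall>i\<in>{1..p}. C i \<subseteq> H\<^sub>0 \<union> H"
    using D1[rule_format, OF H\<^sub>0(1) H(1)] by (elim exE conjE)
  have C_edge: "C k \<in> \<H>" if "k \<le> p" for k using C(1) that unfolding chain_def by blast
  \<comment> \<open>Confining the chain to the union keeps each of its hyperedges in the support of
    \<open>u\<close>, hence playable.\<close>
  have "C k \<subseteq> H\<^sub>0 \<union> H" if "k \<le> p" for k
    using C(2,4) that by (cases k) auto
  then have C_pos: "u i > 0" if "k \<le> p" "i \<in> C k" for k i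
    using that pos0[of i] H(2)[of i] by (metis UnE subsetD)
  let ?low = "\<lambda>k. height \<H> (zeroed (C k)) \<le> t"
  \<comment> \<open>The last hyperedge of the chain is low because
    \<open>min_coord u \<le> t\<close>; all those before \<open>k\<close> leave height above
    \<open>t\<close>.\<close>
  define k where "k = (LEAST k. ?low k)"
  have "?low p" using H(3) t C(3) by simp
  then have "?low k" "k \<le> p" unfolding k_def by (rule LeastI, rule Least_le)
  have "high (C k)"
  proof (cases k)
    case 0
    then show ?thesis using high0 C(2) by simp
  next
    case (Suc j)
    then have j: "t < height \<H> (zeroed (C j))"
      using not_less_Least[of j ?low] unfolding k_def by (simp add: not_le)
    have link: "C k \<inter> C j \<noteq> {}" "card (C k - C j) \<le> 1"
      using C(1) Suc \<open>k \<le> p\<close> unfolding chain_def by auto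
    let ?w = "\<lambda>i. if i \<in> C k then if i \<in> C j then 0 else u i - 1 else u i"
    have "t \<le> height \<H> ?w"
    proof (cases "C k \<subseteq> C j")
      case True
      then have "zeroed (C j) i \<le> ?w i" for i unfolding zeroed_def by auto
      then show ?thesis using j height_mono by (meson less_imp_le order_trans)
    next
      case False
      then obtain i where i: "i \<in> C k" "i \<notin> C j" by blast
      then have "C k - C j = {i}"
        using link(2) card_le_Suc0_iff_eq[of "C k - C j"] by auto
      then have "((zeroed (C j))(i := zeroed (C j) i - 1)) l \<le> ?w l" for l
        using i unfolding zeroed_def by auto
      then have "height \<H> ((zeroed (C j))(i := zeroed (C j) i - 1)) \<le> height \<H> ?w"
        by (rule height_mono)
      then show ?thesis using j height_decrement[of "zeroed (C j)" i] by linarith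
    qed
    moreover have "\<exists>i. ?w i = 0" using link(1) by auto
    moreover have "\<forall>i\<in>C k. ?w i < u i" using C_pos[OF \<open>k \<le> p\<close>] by simp
    ultimately show ?thesis unfolding high_def by (intro exI[of _ ?w]) auto
  qed
  then obtain w' where w': "\<forall>i\<in>C k. w' i < u i" "\<forall>i. i \<notin> C k \<longrightarrow> w' i = u i"
      "\<exists>i. w' i = 0" "t \<le> height \<H> w'"
    unfolding high_def by blast
  have "zeroed (C k) i \<le> w' i" for i unfolding zeroed_def using w'(2) by auto
  then obtain u' where u': "\<And>i. zeroed (C k) i \<le> u' i" "\<And>i. u' i \<le> w' i" "height \<H> u' = t"
    using height_descent \<open>?low k\<close> w'(4) by blast
  have "move \<H> u u'"
  proof (rule moveI[OF C_edge[OF \<open>k \<le> p\<close>]])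
    show "u' i < u i" if "i \<in> C k" for i using that u'(2) w'(1) by (meson le_less_trans)
    show "u' i = u i" if "i \<notin> C k" for i
      using that u'(1)[of i] u'(2)[of i] w'(2) unfolding zeroed_def by simp
  qed
  moreover have "min_coord u' = 0" using w'(3) u'(2) min_coord_eq_0_iff by (metis le_zero_eq)
  ultimately show thesis using that u'(3) by blast
qed

lemma reach_height_of_min_zero:
  assumes "min_coord u = 0" "t < height \<H> u"
  obtains u' where "move \<H> u u'" "min_coord u' = 0" "height \<H> u' = t"
proof -
  obtain H where H: "H \<in> \<H>" "\<And>i. i \<in> H \<Longrightarrow> u i > 0" "t \<le> height \<H> (\<lambda>i. u i - indicator H i)"
    using good_edge_exists[OF assms(2)] by blast
  have "move \<H> u (\<lambda>i. u i - indicator H i)"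
    using H by (intro moveI[of H]) auto
  moreover have "min_coord (\<lambda>i. u i - indicator H i) = 0"
    using assms(1) unfolding min_coord_eq_0_iff by (metis diff_0_eq_0)
  ultimately show thesis using reach_height_zero_min H(3) assms(1) that by (metis le0)
qed

section \<open>Using (D2) to reach every smaller value of \<open>f_val\<close>\<close>

context
  assumes D2: "\<forall>x. min_coord x > 0 \<longrightarrow>
               (\<exists>H\<in>\<H>. height \<H> (\<lambda>i. x i - indicator H i) = height \<H> x - 1 \<and>
                       min_coord (\<lambda>i. x i - indicator H i) = min_coord x - 1)"
begin

text \<open>The minimum drops only if \<open>H\<close> contains a vertex attaining it. Height and
  minimum of \<open>x\<close> are positive, so the equations of (D2) take successor form.\<close>

lemma min_edge_exists:
  assumes "min_coord x > 0"
  obtains H i where "H \<in> \<H>" "i \<in> H" "x i = min_coord x"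
    "height \<H> x = Suc (height \<H> (\<lambda>j. x j - indicator H j))"
    "min_coord x = Suc (min_coord (\<lambda>j. x j - indicator H j))"
proof -
  obtain H where H: "H \<in> \<H>" "height \<H> (\<lambda>i. x i - indicator H i) = height \<H> x - 1"
      "min_coord (\<lambda>i. x i - indicator H i) = min_coord x - 1"
    using D2 assms by blast
  obtain i where i: "x i - indicator H i = min_coord x - 1"
    using min_coord_attained[of "\<lambda>i. x i - indicator H i"] H(3) by metis
  then have "i \<in> H \<and> x i = min_coord x"
    using assms min_coord_le[of x i] by (cases "i \<in> H") auto
  moreover have "height \<H> x = Suc (height \<H> (\<lambda>j. x j - indicator H j))"
    unfolding H(2) using height_pos[OF hyp assms] by simp
  moreover have "min_coord x = Suc (min_coord (\<lambda>j. x j - indicator H j))"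
    unfolding H(3) using assms by simp
  ultimately show thesis using that H(1) by blast
qed

text \<open>Moves from (D2), repeated \<open>min_coord x\<close> times, each cost exactly one unit
  of height and of minimum; the final position dominates the shifted one.\<close>

lemma height_ge_min_add: "min_coord x + height \<H> (\<lambda>i. x i - min_coord x) \<le> height \<H> x"
proof (induction "min_coord x" arbitrary: x)
  case 0
  then show ?case by simp
next
  case (Suc n)
  then obtain H where H: "height \<H> x = Suc (height \<H> (\<lambda>j. x j - indicator H j))"
      "min_coord x = Suc (min_coord (\<lambda>j. x j - indicator H j))"
    using min_edge_exists[of x] by (metis zero_less_Suc)
  let ?x = "\<lambda>j. x j - indicator H j"
  have n: "min_coord ?x = n" using H(2) Suc.hyps(2) by simp
  then have IH: "n + height \<H> (\<lambda>i. ?x i - n) \<le> height \<H> ?x"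
    using Suc.hyps(1)[of ?x] by simp
  have "height \<H> (\<lambda>i. x i - Suc n) \<le> height \<H> (\<lambda>i. ?x i - n)"
    by (intro height_mono) (auto simp: indicator_def)
  then show ?case using IH H(1) Suc.hyps(2)[symmetric] by simp
qed

text \<open>Translating by \<open>c\<close> makes \<open>d\<close> the minimum. A move to minimum
  zero and height \<open>t\<close> then translates back to minimum \<open>c\<close> and shifted
  height \<open>t\<close>.\<close>

lemma reach_shift:
  assumes d: "d \<le> min_coord x" "d \<le> t" and t: "t \<le> height \<H> (\<lambda>i. x i - min_coord x)"
    and not_stay: "d = 0 \<Longrightarrow> t < height \<H> (\<lambda>i. x i - min_coord x)"
  obtains x' where "move \<H> x x'" "min_coord x' = min_coord x - d"
    "height \<H> (\<lambda>i. x' i - min_coord x') = t"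
proof -
  define c where "c = min_coord x - d"
  define u where "u = (\<lambda>i. x i - c)"
  have u_min: "min_coord u = d" unfolding u_def min_coord_diff c_def using d(1) by simp
  have u_shift: "(\<lambda>i. u i - d) = (\<lambda>i. x i - min_coord x)"
    unfolding u_def c_def using d(1) by simp
  obtain u' where u': "move \<H> u u'" "min_coord u' = 0" "height \<H> u' = t"
  proof (cases "d = 0")
    case True
    then have "t < height \<H> u" using not_stay u_shift by simp
    then show thesis using reach_height_of_min_zero[of u t] u_min True that by blast
  next
    case False
    then obtain H i where H: "H \<in> \<H>" "i \<in> H" "u i = d"
        "height \<H> u = Suc (height \<H> (\<lambda>j. u j - indicator H j))"
      using min_edge_exists[of u] u_min by (metis not_gr_zero)
    let ?v = "\<lambda>j. u j - indicator H j"
    have pos: "u j > 0" for j using False u_min min_coord_le[of u j] by linarith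
    \<comment> \<open>The unit move costs one unit of height and zeroing \<open>i\<close> at most
      \<open>d - 1\<close> more. The remaining height is at least \<open>height u - d\<close>, hence
      at least that of the shifted position.\<close>
    have "move \<H> u (?v(i := 0))" using H pos by (intro moveI[of H]) auto
    moreover have "min_coord (?v(i := 0)) = 0" unfolding min_coord_eq_0_iff by auto
    moreover have "t \<le> height \<H> (?v(i := 0))"
      using height_set_zero[of ?v i] height_ge_min_add[of u] u_min u_shift t H False by simp
    ultimately show thesis using reach_height_zero_min u_min d(2) that by metis
  qed
  define x' where "x' = (\<lambda>i. u' i + c)"
  have c_le: "c \<le> x i" for i unfolding c_def using min_coord_le[of x i] by simp
  from u'(1) obtain H where H: "H \<in> \<H>" "\<And>i. i \<in> H \<Longrightarrow> u' i < u i" "\<And>i. i \<notin> H \<Longrightarrow> u' i = u i"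
    by (rule moveE) blast
  have "move \<H> x x'"
  proof (rule moveI[OF H(1)])
    show "x' i < x i" if "i \<in> H" for i using H(2)[OF that] unfolding x'_def u_def by simp
    show "x' i = x i" if "i \<notin> H" for i using H(3)[OF that] c_le[of i] unfolding x'_def u_def by simp
  qed
  moreover have "min_coord x' = c" unfolding x'_def min_coord_add u'(2) by simp
  ultimately show thesis using that[of x'] u'(3) unfolding c_def x'_def by simp
qed

text \<open>The target gets \<open>y_val\<close> equal to the block number \<open>n\<close> of
  \<open>z\<close>, and a minimum congruent to \<open>z + 1\<close> modulo \<open>n\<close> and
  above \<open>z\<close>; its second-branch value is then \<open>z\<close>. The last hypothesis
  excludes keeping both minimum and \<open>y_val\<close>.\<close>

lemma reach_below_min:
  assumes z: "z < min_coord x" "z = (n choose 2) + r" "r < n"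
    and n: "n \<le> y_val \<H> x" and stay: "n = y_val \<H> x \<Longrightarrow> (min_coord x - z - 1) mod n \<noteq> 0"
  shows "\<exists>x'. move \<H> x x' \<and> f_val \<H> x' = z"
proof -
  \<comment> \<open>The least decrease of the minimum that yields the required congruence;
    \<open>d < n\<close> provides the bound \<open>d \<le> n - 1\<close> on the shifted
    height.\<close>
  define d where "d = (min_coord x - z - 1) mod n"
  have "d < n" unfolding d_def using z(3) by simp
  have d_le: "d \<le> min_coord x - z - 1" unfolding d_def by simp
  obtain x' where x': "move \<H> x x'" "min_coord x' = min_coord x - d"
      "height \<H> (\<lambda>i. x' i - min_coord x') = n - 1"
  proof (rule reach_shift[of d x "n - 1"])
    show "n - 1 < height \<H> (\<lambda>i. x i - min_coord x)" if "d = 0"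
      using that stay n z(3) unfolding y_val_def d_def by fastforce
  qed (use d_le \<open>d < n\<close> n in \<open>auto simp: y_val_def\<close>)
  have y: "y_val \<H> x' = n" using x'(3) z(3) unfolding y_val_def by simp
  have "min_coord x' - (n choose 2) - 1 = r + (min_coord x - z - 1 - d)"
    using x'(2) d_le z(1,2) by simp
  moreover have "(min_coord x - z - 1 - d) mod n = 0"
    unfolding d_def by (simp add: minus_mod_eq_mult_div)
  ultimately have "(min_coord x' - (n choose 2) - 1) mod n = r"
    using z(3) by (metis add.right_neutral mod_add_right_eq mod_less)
  moreover have "n choose 2 < min_coord x'" using x'(2) d_le z(1,2) by simp
  ultimately have "f_val \<H> x' = z"
    using v_val_eq[of x'] y z(2) by (simp add: f_val_def)
  then show ?thesis using x'(1) by blast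
qed

text \<open>Let (D2) supply \<open>H\<close> and a vertex \<open>i\<close> in it attaining the
  minimum. Small \<open>z\<close> are reached with minimum zero; larger \<open>z\<close> by lowering
  the other vertices of \<open>H\<close> by one and varying only the value at
  \<open>i\<close>.\<close>

lemma reach_above_min:
  assumes long: "min_coord x \<le> y_val \<H> x choose 2"
    and z: "min_coord x \<le> z" "z < height \<H> x"
  shows "\<exists>x'. move \<H> x x' \<and> f_val \<H> x' = z"
proof (cases "min_coord x = 0")
  case True
  then show ?thesis using reach_height_of_min_zero[OF True z(2)] by (metis f_val_def le0)
next
  case False
  then obtain H i where H: "H \<in> \<H>" "i \<in> H" "x i = min_coord x"
      "height \<H> x = Suc (height \<H> (\<lambda>j. x j - indicator H j))"
    using min_edge_exists[of x] by (metis not_gr_zero)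
  let ?v = "\<lambda>j. x j - indicator H j"
  have pos: "x j > 0" for j using False min_coord_le[of x j] by linarith
  have mv: "move \<H> x w" if "\<And>j. (?v(i := 0)) j \<le> w j" "\<And>j. w j \<le> ?v j" for w
  proof (rule moveI[OF H(1)])
    show "w j < x j" if "j \<in> H" for j
      using that pos[of j] \<open>\<And>j. w j \<le> ?v j\<close>[of j] by simp
    show "w j = x j" if "j \<notin> H" for j
      using that H(2) \<open>\<And>j. w j \<le> ?v j\<close>[of j] \<open>\<And>j. (?v(i := 0)) j \<le> w j\<close>[of j]
      by (cases "j = i") auto
  qed
  show ?thesis
  proof (cases "z \<le> height \<H> (?v(i := 0))")
    case True
    have "move \<H> x (?v(i := 0))" by (rule mv) auto
    moreover have "min_coord (?v(i := 0)) = 0" unfolding min_coord_eq_0_iff by auto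
    ultimately show ?thesis using reach_height_zero_min True z(1) by (metis f_val_def le0)
  next
    case False
    obtain w where w: "\<And>j. (?v(i := 0)) j \<le> w j" "\<And>j. w j \<le> ?v j" "height \<H> w = z"
    proof (rule height_descent[of "?v(i := 0)" ?v z])
      show "z \<le> height \<H> ?v" using H(4) z(2) by simp
    qed (use False in auto)
    have wi: "min_coord w < min_coord x"
      using w(2)[of i] H(2,3) pos[of i] min_coord_le[of w i] by simp
    \<comment> \<open>Away from \<open>i\<close> a coordinate loses at most one while the minimum
      loses at least one; at \<open>i\<close> the left side is 0. So \<open>y_val\<close> does not
      decrease, and \<open>w\<close> stays in the height branch.\<close>
    have "x j - min_coord x \<le> w j - min_coord w" for j
    proof (cases "j = i")
      case False
      then have "x j - 1 \<le> w j" using w(1)[of j] by (cases "j \<in> H") auto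
      then show ?thesis using wi by linarith
    qed (use H(3) in simp)
    then have "y_val \<H> x \<le> y_val \<H> w" unfolding y_val_def using height_mono by simp
    then have "min_coord w \<le> y_val \<H> w choose 2"
      using long wi choose_two_mono[of "y_val \<H> x" "y_val \<H> w"] by linarith
    then have "f_val \<H> w = z" using w(3) unfolding f_val_def by simp
    then show ?thesis using mv w(1,2) by blast
  qed
qed

text \<open>Values of at least \<open>min_coord x\<close> occur only in the height branch. For
  smaller \<open>z\<close> the block number \<open>n\<close> is compared with
  \<open>y_val\<close>.\<close>

lemma f_val_reach:
  assumes "z < f_val \<H> x"
  shows "\<exists>x'. move \<H> x x' \<and> f_val \<H> x' = z"
proof (cases "z < min_coord x")
  case False
  then have long: "min_coord x \<le> y_val \<H> x choose 2"
    using assms v_val_less_min_coord[of x] unfolding f_val_def by (auto split: if_splits)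
  then show ?thesis using reach_above_min False assms unfolding f_val_def by simp
next
  case True
  obtain n r where nr: "z = (n choose 2) + r" "r < n" by (rule choose_two_decomp)
  let ?y = "y_val \<H> x"
  show ?thesis
  proof (cases "min_coord x \<le> ?y choose 2")
    case long: True
    then have "n < ?y" using True nr(1) choose_two_mono[of ?y n] by linarith
    then show ?thesis using reach_below_min[OF True nr] by simp
  next
    case False
    define q where "q = min_coord x - (?y choose 2) - 1"
    have less: "z < (?y choose 2) + q mod ?y"
      using assms False v_val_eq[of x] unfolding f_val_def q_def by simp
    have "n \<le> ?y"
    proof (rule ccontr)
      assume "\<not> n \<le> ?y"
      then have "(?y choose 2) + q mod ?y < n choose 2"
        by (intro choose_two_add_less) (simp_all add: y_val_pos)
      then show False using less nr(1) by simp
    qed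
    moreover have "(min_coord x - z - 1) mod n \<noteq> 0" if "n = ?y"
    proof
      \<comment> \<open>In the block of \<open>f_val\<close> at \<open>x\<close>, this congruence
        would make \<open>r\<close> the residue of \<open>q\<close>, so \<open>z\<close> would equal
        that value.\<close>
      assume "(min_coord x - z - 1) mod n = 0"
      moreover have "q = min_coord x - z - 1 + r"
        using that nr(1) True unfolding q_def by simp
      ultimately have "q mod ?y = r" using nr(2) that
        by (metis add.commute add.right_neutral mod_add_right_eq mod_less)
      then show False using less nr(1) that by simp
    qed
    ultimately show ?thesis using reach_below_min[OF True nr] by blast
  qed
qed

text \<open>Since no move preserves \<open>f_val\<close> and all smaller values are reached,
  \<open>f_val\<close> satisfies the mex recursion, which determines its solution by
  well-foundedness.\<close>

lemma grundy_eq_f_val: "grundy \<H> x = f_val \<H> x"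
proof (induction x rule: wf_induct_rule[OF wf_move[OF hyp]])
  case (1 x)
  then have "grundy \<H> x = mex {f_val \<H> x' |x'. move \<H> x x'}"
    unfolding grundy_eq[OF hyp, of x] by (intro arg_cong[where f = mex]) force
  also have "\<dots> = f_val \<H> x"
    unfolding mex_def
  proof (rule Least_equality)
    show "f_val \<H> x \<notin> {f_val \<H> x' |x'. move \<H> x x'}"
      using f_val_move_neq[OF tf] by fastforce
    show "f_val \<H> x \<le> k" if "k \<notin> {f_val \<H> x' |x'. move \<H> x x'}" for k
      using that f_val_reach[of k x] by (metis (mono_tags, lifting) mem_Collect_eq not_le)
  qed
  finally show ?case .
qed

end

end

end

theorem theorem4p4:
  fixes \<H> :: "'v::finite set set"
  assumes "hypergraph \<H>"
    and A1: "minimal_transversal_free \<H>"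
    and D1: "\<forall>H\<in>\<H>. \<forall>H'\<in>\<H>. \<exists>p C. chain \<H> p C \<and> C 0 = H \<and> C p = H' \<and>
               (\<forall>i\<in>{1..p}. C i \<subseteq> H \<union> H')"
    and D2: "\<forall>x. min_coord x > 0 \<longrightarrow>
               (\<exists>H\<in>\<H>. height \<H> (\<lambda>i. x i - indicator H i) = height \<H> x - 1 \<and>
                       min_coord (\<lambda>i. x i - indicator H i) = min_coord x - 1)"
  shows "JM \<H>"
  unfolding JM_def using grundy_eq_f_val[OF assms] by blast

end
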